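(* For every positive integer $n$, there is a bijection between the set of marked partitions of $n$ and the set of doubly marked partitions of $n$.
   Context: Partitions are written with weakly decreasing parts $\mu=(\mu_1,\dots,\mu_\ell)$; $s(\mu)$ denotes the smallest part. A marked partition of $n$ is a pair $(\mu,k)$ where $\mu$ is a partition of $n$ and $k$ is an index with $\mu_k=s(\mu)$ (i.e. one of the smallest parts is marked by its position). For a partition $\lambda$, $\lambda'$ is its conjugate (so $\lambda'_s$ is the number of parts $\ge s$) and $D(\lambda)$ the side length of its Durfee square. A doubly marked partition of $n$ is a triple $(\lambda,s,t)$ with $\lambda$ a partition of $n$ and integers $1\le s\le D(\lambda)$, $s\le t\le\lambda_1$, $\lambda'_s=\lambda'_t$. *)

theory Defs
  imports Main
begin

definition partitions :: "nat \<Rightarrow> nat list set" where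
  "partitions n = {\<nu>. sorted_wrt (\<ge>) \<nu> \<and> (\<forall>x\<in>set \<nu>. 0 < x) \<and> sum_list \<nu> = n}"

(* Parts are indexed from 1, and all parts beyond the length are 0. *)
definition part_at :: "nat list \<Rightarrow> nat \<Rightarrow> nat" where
  "part_at \<nu> i = (if 1 \<le> i \<and> i \<le> length \<nu> then \<nu> ! (i - 1) else 0)"

definition smallest_part :: "nat list \<Rightarrow> nat" where
  "smallest_part \<mu> = Min (set \<mu>)"

definition conjugate :: "nat list \<Rightarrow> nat list" where
  "conjugate \<nu> = map (\<lambda>j. length (filter (\<lambda>x. x \<ge> j) \<nu>)) [1..<Suc (part_at \<nu> 1)]"

definition young_diagram :: "nat list \<Rightarrow> (nat \<times> nat) set" where
  "young_diagram \<nu> = {(i, j). 1 \<le> i \<and> i \<le> length \<nu> \<and> 1 \<le> j \<and> j \<le> part_at \<nu> i}"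

(* The set below contains 0 and is bounded by the length of \<nu>, so Max is proper. *)
definition durfee :: "nat list \<Rightarrow> nat" where
  "durfee \<nu> = Max {d. {1..d} \<times> {1..d} \<subseteq> young_diagram \<nu>}"

definition marked_partitions :: "nat \<Rightarrow> (nat list \<times> nat) set" where
  "marked_partitions n =
    {(\<mu>, k). \<mu> \<in> partitions n \<and> 1 \<le> k \<and> k \<le> length \<mu> \<and> part_at \<mu> k = smallest_part \<mu>}"

definition doubly_marked_partitions :: "nat \<Rightarrow> (nat list \<times> nat \<times> nat) set" where
  "doubly_marked_partitions n =
    {(\<nu>, s, t). \<nu> \<in> partitions n \<and> 1 \<le> s \<and> s \<le> durfee \<nu> \<and> s \<le> t \<and> t \<le> part_at \<nu> 1 \<and>
      part_at (conjugate \<nu>) s = part_at (conjugate \<nu>) t}"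

end

theory Submission imports Defs begin

text \<open>
  Both sides are refined by a parameter \<open>d \<ge> 1\<close>. For a marked partition, \<open>d\<close> is the number of
  copies of the smallest part from the mark to the end; for a doubly marked partition
  \<open>(\<lambda>, s, t)\<close> it is the excess \<open>\<lambda>'\<^sub>s - s + 1\<close>. Writing \<open>x d n\<close> for either refined count and \<open>p n\<close>
  for the number of partitions of \<open>n\<close>, elementary bijections show
  \<open>x d (n + d) + x (d + 1) n = p n + x d n\<close> and \<open>x d n = 0\<close> for \<open>n < d\<close>. Hence the two refined counts
  agree, by induction on \<open>n\<close>.
\<close>

section \<open>Weakly decreasing lists and finiteness\<close>

text \<open>Large entries come first in a weakly decreasing list, so both filters are contiguous
  blocks. This is what allows cutting a partition at a threshold.\<close>

lemma sorted_ge_filter_append: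
  fixes xs :: "nat list"
  assumes "sorted_wrt (\<ge>) xs"
  shows "xs = filter (\<lambda>x. x \<ge> s) xs @ filter (\<lambda>x. x < s) xs"
  using assms
proof (induction xs)
  case (Cons a xs)
  show ?case
  proof (cases "a \<ge> s")
    case True
    then show ?thesis using Cons by auto
  next
    case False
    then have "\<forall>x\<in>set xs. x < s" using Cons.prems by auto
    then have "filter (\<lambda>x. x \<ge> s) xs = []" "filter (\<lambda>x. x < s) xs = xs"
      by (auto simp: filter_empty_conv filter_id_conv)
    then show ?thesis using False by simp
  qed
qed simp

lemma finite_lists_sum_le:
  "finite {xs :: nat list. length xs \<le> k \<and> sum_list xs \<le> n}"
proof (rule finite_subset)
  show "{xs :: nat list. length xs \<le> k \<and> sum_list xs \<le> n} \<subseteq> {xs. set xs \<subseteq> {..n} \<and> length xs \<le> k}"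
    using member_le_sum_list order_trans by fastforce
qed (simp add: finite_lists_length_le)

lemma length_le_sum_list:
  fixes xs :: "nat list"
  assumes "\<forall>x\<in>set xs. 0 < x"
  shows "length xs \<le> sum_list xs"
  using assms by (induction xs) auto

lemma finite_partitions: "finite (partitions n)"
  by (rule finite_subset[OF _ finite_lists_sum_le[of n n]])
     (auto simp: partitions_def dest: length_le_sum_list)

section \<open>The two refined families\<close>

text \<open>
  \<open>(N, b)\<close> stands for the partition \<open>b\<close> followed by \<open>d\<close> copies of \<open>N\<close>, marked at the first of these.
\<close>

definition based_partitions :: "nat \<Rightarrow> nat \<Rightarrow> (nat \<times> nat list) set" where
  "based_partitions d n = {(N, b). 1 \<le> N \<and> sorted_wrt (\<ge>) b \<and> (\<forall>x\<in>set b. N \<le> x)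
     \<and> sum_list b + d * N = n}"

text \<open>
  \<open>(j, t, a, b)\<close> stands for a rectangle with \<open>j + d\<close> rows and \<open>t\<close> columns, to the right of which lies
  \<open>a\<close> (padded with zeros) and below which lies \<open>b\<close>, confined to the first \<open>j\<close> columns. If \<open>j < t\<close>, the
  columns \<open>j + 1, \<dots>, t\<close> all have height \<open>j + d\<close>, which is the situation of a double mark with
  \<open>s = j + 1\<close>. If \<open>j = t\<close>, the rectangle is the maximal one of shape \<open>(j + d) \<times> j\<close>, so that every
  partition arises exactly once.
\<close>

definition framed_partitions :: "nat \<Rightarrow> nat \<Rightarrow> (nat \<times> nat \<times> nat list \<times> nat list) set" where
  "framed_partitions d n = {(j, t, a, b). j \<le> t \<and> sorted_wrt (\<ge>) a \<and> length a = j + d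
     \<and> sorted_wrt (\<ge>) b \<and> (\<forall>x\<in>set b. 1 \<le> x \<and> x \<le> j)
     \<and> sum_list a + (j + d) * t + sum_list b = n}"

definition strict_framed_partitions :: "nat \<Rightarrow> nat \<Rightarrow> (nat \<times> nat \<times> nat list \<times> nat list) set" where
  "strict_framed_partitions d n = {(j, t, a, b) \<in> framed_partitions d n. j < t}"

lemma finite_based_partitions:
  assumes "1 \<le> d"
  shows "finite (based_partitions d n)"
proof (rule finite_subset)
  show "based_partitions d n \<subseteq> {..n} \<times> {xs. length xs \<le> n \<and> sum_list xs \<le> n}"
  proof clarify
    fix N b assume *: "(N, b) \<in> based_partitions d n"
    then have "length b \<le> sum_list b"
      by (intro length_le_sum_list) (auto simp: based_partitions_def)
    moreover have "N \<le> d * N" using assms by (cases d) auto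
    moreover have "sum_list b + d * N = n" using * by (simp add: based_partitions_def)
    ultimately have "N \<le> n" "length b \<le> n" by linarith+
    then show "N \<in> {..n} \<and> b \<in> {xs. length xs \<le> n \<and> sum_list xs \<le> n}"
      using * by (auto simp: based_partitions_def)
  qed
qed (simp add: finite_lists_sum_le)

text \<open>Since \<open>d\<close> is positive, the rectangle has at least one row and hence at
  least \<open>t\<close> cells. This bounds \<open>t\<close>, then \<open>j\<close> and the length
  of \<open>a\<close>.\<close>

lemma finite_framed_partitions:
  assumes "1 \<le> d"
  shows "finite (framed_partitions d n)"
proof (rule finite_subset)
  let ?L = "{xs :: nat list. length xs \<le> n + d \<and> sum_list xs \<le> n}"
  show "framed_partitions d n \<subseteq> {..n} \<times> {..n} \<times> ?L \<times> ?L"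
  proof
    fix q assume q: "q \<in> framed_partitions d n"
    obtain j t a b where q': "q = (j, t, a, b)" by (cases q) auto
    have sum: "sum_list a + (j + d) * t + sum_list b = n" and *: "length a = j + d" "j \<le> t"
      and pos: "\<forall>x\<in>set b. 0 < x"
      using q q' by (auto simp: framed_partitions_def)
    have "t \<le> (j + d) * t" using assms by (cases "j + d") auto
    then have "t \<le> n" using sum by linarith
    moreover have "length b \<le> n" using length_le_sum_list[OF pos] sum by simp
    ultimately show "q \<in> {..n} \<times> {..n} \<times> ?L \<times> ?L" using q' sum * by simp
  qed
qed (simp add: finite_lists_sum_le)

lemma finite_strict_framed_partitions:
  assumes "1 \<le> d"
  shows "finite (strict_framed_partitions d n)"
  by (rule finite_subset[OF _ finite_framed_partitions[OF assms, of n]])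
     (auto simp: strict_framed_partitions_def)

section \<open>Recurrence for marked partitions\<close>

text \<open>Split \<open>based_partitions d n\<close> by whether \<open>N\<close> occurs in
  \<open>b\<close>. If it does, that copy joins the \<open>d\<close> copies at the end, giving
  parameter \<open>Suc d\<close>. If it does not, all \<open>d\<close> copies can be raised by one,
  adding \<open>d\<close> to the size.\<close>

lemma card_based_partitions_rec:
  assumes d: "1 \<le> d"
  shows "card (based_partitions d (n + d)) + card (based_partitions (Suc d) n)
    = card (partitions n) + card (based_partitions d n)"
proof -
  let ?Q = "based_partitions d n"
  let ?G = "{(N, b) \<in> ?Q. \<forall>x\<in>set b. N < x}"
  let ?L = "{(N, b) \<in> ?Q. \<not> (\<forall>x\<in>set b. N < x)}"
  have fin: "finite ?G" "finite ?L"
    by (auto intro: finite_subset[OF _ finite_based_partitions[OF d, of n]])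
  have Q: "?Q = ?G \<union> ?L" "?G \<inter> ?L = {}" by auto
  have cardQ: "card ?Q = card ?G + card ?L"
    using card_Un_disjoint[OF fin Q(2)] Q(1) by simp
  \<comment> \<open>\<open>N\<close> is a lower bound of the decreasing list \<open>b\<close>, so if
    it occurs at all, it occurs at the end.\<close>
  have last: "\<exists>c. b = c @ [N]" if "(N, b) \<in> ?L" for N b
  proof -
    have "b \<noteq> []" using that by auto
    then obtain c y where "b = c @ [y]" by (cases b rule: rev_cases) auto
    then show ?thesis using that by (auto simp: based_partitions_def sorted_wrt_append)
  qed
  have "?L = (\<lambda>(N, b). (N, b @ [N])) ` based_partitions (Suc d) n" (is "_ = ?g ` ?R")
  proof
    show "?L \<subseteq> ?g ` ?R"
    proof
      fix q assume q: "q \<in> ?L"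
      obtain N b where q': "q = (N, b)" by (cases q) auto
      then obtain c where "b = c @ [N]" using q last by blast
      then have "(N, c) \<in> ?R" "q = ?g (N, c)"
        using q q' by (auto simp: based_partitions_def sorted_wrt_append)
      then show "q \<in> ?g ` ?R" by blast
    qed
  qed (auto simp: based_partitions_def sorted_wrt_append)
  moreover have "inj_on ?g ?R" by (auto simp: inj_on_def)
  ultimately have cardL: "card (based_partitions (Suc d) n) = card ?L"
    by (simp add: card_image)
  have inj: "inj (\<lambda>(N, b). (Suc N, b :: nat list))" by (auto simp: inj_def)
  \<comment> \<open>Lowering the base by one leaves either 0, with \<open>b\<close> an arbitrary
    partition of \<open>n\<close>, or a positive base below every part of \<open>b\<close>.\<close>
  have "based_partitions d (n + d) = (\<lambda>(N, b). (Suc N, b)) ` (Pair 0 ` partitions n \<union> ?G)"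
    (is "_ = ?s ` ?R")
  proof
    show "based_partitions d (n + d) \<subseteq> ?s ` ?R"
    proof clarify
      fix N b assume *: "(N, b) \<in> based_partitions d (n + d)"
      then obtain M where N: "N = Suc M" by (cases N) (auto simp: based_partitions_def)
      have "(M, b) \<in> ?R"
        using * N by (cases M) (auto simp: based_partitions_def partitions_def Suc_le_eq)
      then show "(N, b) \<in> ?s ` ?R" using N by force
    qed
    show "?s ` ?R \<subseteq> based_partitions d (n + d)"
      by (auto simp: based_partitions_def partitions_def Suc_le_eq)
  qed
  then have "card (based_partitions d (n + d)) = card ?R"
    by (simp only: card_image[OF inj_on_subset[OF inj subset_UNIV]])
  also have "\<dots> = card (Pair 0 ` partitions n :: (nat \<times> nat list) set) + card ?G"
    by (rule card_Un_disjoint)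
       (use fin in \<open>auto simp: finite_partitions based_partitions_def\<close>)
  also have "card (Pair 0 ` partitions n :: (nat \<times> nat list) set) = card (partitions n)"
    by (simp add: card_image inj_on_def)
  finally show ?thesis using cardQ cardL by simp
qed

section \<open>Recurrence for doubly marked partitions\<close>

text \<open>
  If \<open>j\<close> is a part of \<open>b\<close> (or \<open>j = 0\<close>), exchange one such row for an additional column of the
  rectangle. Otherwise \<open>b\<close> does not reach column \<open>j\<close>, and the same diagram is framed with \<open>j - 1\<close>
  and \<open>d + 1\<close>.
\<close>

lemma card_framed_partitions_split:
  assumes d: "1 \<le> d"
  shows "card (framed_partitions d n)
    = card (strict_framed_partitions d (n + d)) + card (strict_framed_partitions (Suc d) n)"
proof -
  let ?E = "framed_partitions d n"
  let ?C = "{(j, t, a, b) \<in> ?E. j = 0 \<or> j \<in> set b}"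
  let ?D = "{(j, t, a, b) \<in> ?E. \<not> (j = 0 \<or> j \<in> set b)}"
  have fin: "finite ?C" "finite ?D"
    by (auto intro: finite_subset[OF _ finite_framed_partitions[OF d, of n]])
  have E: "?E = ?C \<union> ?D" "?C \<inter> ?D = {}" by auto
  have cardE: "card ?E = card ?C + card ?D"
    using card_Un_disjoint[OF fin E(2)] E(1) by simp
  have hd: "\<exists>c. b = j # c" if "(j, t, a, b) \<in> ?E" "j \<in> set b" for j t a b
    using that by (cases b) (auto simp: framed_partitions_def intro: le_antisym)
  \<comment> \<open>The new column has \<open>j + d\<close> cells and the removed row has
    \<open>j\<close>, so the size grows by \<open>d\<close>. For \<open>j = 0\<close> the list
    \<open>b\<close> is empty and no row is removed.\<close>
  have "bij_betw (\<lambda>(j, t, a, b). (j, Suc t, a, if j = 0 then b else tl b))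
          ?C (strict_framed_partitions d (n + d))"
  proof (rule bij_betw_byWitness[where f' = "\<lambda>(j, t, a, b). (j, t - 1, a, if j = 0 then b else j # b)"])
    show "\<forall>q\<in>?C. (\<lambda>(j, t, a, b). (j, t - 1, a, if j = 0 then b else j # b))
        ((\<lambda>(j, t, a, b). (j, Suc t, a, if j = 0 then b else tl b)) q) = q"
      by (auto dest!: hd)
    show "\<forall>q\<in>strict_framed_partitions d (n + d).
        (\<lambda>(j, t, a, b). (j, Suc t, a, if j = 0 then b else tl b))
        ((\<lambda>(j, t, a, b). (j, t - 1, a, if j = 0 then b else j # b)) q) = q"
      by (auto simp: strict_framed_partitions_def)
    show "(\<lambda>(j, t, a, b). (j, Suc t, a, if j = 0 then b else tl b)) ` ?C
        \<subseteq> strict_framed_partitions d (n + d)"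
    proof (rule image_subsetI)
      fix q assume q: "q \<in> ?C"
      obtain j t a b where q': "q = (j, t, a, b)" by (cases q) auto
      show "(case q of (j, t, a, b) \<Rightarrow> (j, Suc t, a, if j = 0 then b else tl b))
          \<in> strict_framed_partitions d (n + d)"
      proof (cases "j = 0")
        case True
        then show ?thesis
          using q q' by (auto simp: framed_partitions_def strict_framed_partitions_def)
      next
        case False
        then obtain c where "b = j # c" using q q' hd[of j t a b] by auto
        then show ?thesis
          using q q' False by (auto simp: framed_partitions_def strict_framed_partitions_def)
      qed
    qed
    show "(\<lambda>(j, t, a, b). (j, t - 1, a, if j = 0 then b else j # b))
        ` strict_framed_partitions d (n + d) \<subseteq> ?C"
    proof (rule image_subsetI)
      fix q assume q: "q \<in> strict_framed_partitions d (n + d)"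
      obtain j t a b where q': "q = (j, t, a, b)" by (cases q) auto
      have "j < t" using q q' by (simp add: strict_framed_partitions_def)
      then obtain u where "t = Suc u" by (cases t) auto
      then show "(case q of (j, t, a, b) \<Rightarrow> (j, t - 1, a, if j = 0 then b else j # b)) \<in> ?C"
        using q q' by (auto simp: framed_partitions_def strict_framed_partitions_def)
    qed
  qed
  \<comment> \<open>The number of rows stays the same, as \<open>j - 1 + Suc d = j + d\<close> for
    positive \<open>j\<close>, while \<open>j \<le> t\<close> becomes the strict inequality
    \<open>j - 1 < t\<close>.\<close>
  moreover have "bij_betw (\<lambda>(j, t, a, b). (j - 1, t, a, b)) ?D (strict_framed_partitions (Suc d) n)"
  proof (rule bij_betw_byWitness[where f' = "\<lambda>(j, t, a, b). (Suc j, t, a, b)"])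
    show "(\<lambda>(j, t, a, b). (j - 1, t, a, b)) ` ?D \<subseteq> strict_framed_partitions (Suc d) n"
    proof (rule image_subsetI)
      fix q assume q: "q \<in> ?D"
      obtain j t a b where q': "q = (j, t, a, b)" by (cases q) auto
      have "x \<le> j - 1" if "x \<in> set b" for x
      proof -
        have "x \<le> j" "x \<noteq> j" using q q' that by (auto simp: framed_partitions_def)
        then show ?thesis by simp
      qed
      then show "(case q of (j, t, a, b) \<Rightarrow> (j - 1, t, a, b)) \<in> strict_framed_partitions (Suc d) n"
        using q q' mult_Suc[of "j + d - 1" t]
        by (auto simp: framed_partitions_def strict_framed_partitions_def)
    qed
  qed (auto simp: framed_partitions_def strict_framed_partitions_def)
  ultimately show ?thesis
    using cardE by (simp add: bij_betw_same_card)
qed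

section \<open>Partitions and their maximal rectangles\<close>

text \<open>In contrast to \<^const>\<open>part_at\<close>, parts are indexed from 0 here.\<close>

definition part0 :: "nat list \<Rightarrow> nat \<Rightarrow> nat" where
  "part0 xs i = (if i < length xs then xs ! i else 0)"

lemma part0_antimono:
  assumes "sorted_wrt (\<ge>) xs" "i \<le> k"
  shows "part0 xs k \<le> part0 xs i"
  using assms sorted_wrt_nth_less[of "(\<ge>)" xs i k]
  by (cases "i = k") (auto simp: part0_def)

lemma part0_append: "part0 (xs @ ys) i = (if i < length xs then xs ! i else part0 ys (i - length xs))"
  by (auto simp: part0_def nth_append)

text \<open>Zeros of a weakly decreasing list are trailing, and \<open>part0\<close> returns 0 past
  the end anyway.\<close>

lemma part0_filter_pos:
  assumes "sorted_wrt (\<ge>) xs"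
  shows "part0 (filter (\<lambda>x. 0 < x) xs) i = part0 xs i"
proof -
  have *: "(\<lambda>x :: nat. x \<ge> 1) = (\<lambda>x. 0 < x)" by auto
  have "part0 (filter (\<lambda>x. x < 1) xs) k = 0" for k
    using nth_mem[of k "filter (\<lambda>x. x < 1) xs"] by (auto simp: part0_def simp del: nth_mem)
  then have "part0 (filter (\<lambda>x. 0 < x) xs @ filter (\<lambda>x. x < 1) xs) i = part0 (filter (\<lambda>x. 0 < x) xs) i"
    unfolding part0_append by (simp add: part0_def)
  then show ?thesis using sorted_ge_filter_append[OF assms, of 1] unfolding * by simp
qed

lemma sum_list_map_add: "sum_list (map (\<lambda>x. x + t) a) = sum_list a + length a * (t :: nat)"
  by (induction a) auto

lemma sum_list_filter_pos: "sum_list (filter (\<lambda>x. 0 < x) xs) = sum_list (xs :: nat list)"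
  by (induction xs) auto

lemma sorted_ge_map_add_append:
  fixes a b :: "nat list"
  assumes "sorted_wrt (\<ge>) a" "sorted_wrt (\<ge>) b" "\<forall>x\<in>set b. x \<le> t"
  shows "sorted_wrt (\<ge>) (map (\<lambda>x. x + t) a @ b)"
  using assms by (auto simp: sorted_wrt_append sorted_wrt_map trans_le_add2)

text \<open>Collects what determines the frame from the glued list \<open>F\<close>. Zeros can occur
  in \<open>F\<close> only for \<open>j = 0\<close>, when \<open>a\<close> may contain zeros and
  \<open>b\<close> is empty; the filter removes them.\<close>

lemma framed_partitions_rectangle:
  assumes "(j, j, a, b) \<in> framed_partitions d n"
  defines "F \<equiv> map (\<lambda>x. x + j) a @ b"
  shows "sorted_wrt (\<ge>) F" "sum_list F = n" "part0 F (j + d) \<le> j"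
    "i < j + d \<Longrightarrow> part0 F i = a ! i + j" "filter (\<lambda>x. 0 < x) F \<in> partitions n"
proof -
  have a: "length a = j + d" and b: "\<forall>x\<in>set b. 1 \<le> x \<and> x \<le> j"
    using assms(1) by (auto simp: framed_partitions_def)
  show s: "sorted_wrt (\<ge>) F"
    using assms(1) unfolding F_def by (intro sorted_ge_map_add_append) (auto simp: framed_partitions_def)
  show n: "sum_list F = n"
    using assms(1) by (simp add: F_def sum_list_map_add framed_partitions_def)
  show "part0 F (j + d) \<le> j"
    using a b nth_mem[of 0 b] by (auto simp: F_def nth_append part0_def simp del: nth_mem)
  show "i < j + d \<Longrightarrow> part0 F i = a ! i + j"
    using a by (simp add: F_def part0_append)
  show "filter (\<lambda>x. 0 < x) F \<in> partitions n"
    using s n by (auto simp: partitions_def sum_list_filter_pos sorted_wrt_filter)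
qed

text \<open>Generalizes the Durfee square: each partition has exactly one \<open>j\<close> such that
  its first \<open>j + d\<close> parts, padded with zeros, are at least \<open>j\<close> and all
  later ones at most \<open>j\<close>. The pieces \<open>a\<close> and \<open>b\<close> are then
  forced.\<close>

lemma card_durfee_rectangle:
  assumes d: "1 \<le> d"
  shows "card {(j, t, a, b) \<in> framed_partitions d n. t = j} = card (partitions n)"
proof -
  let ?S = "{(j, t, a, b) \<in> framed_partitions d n. t = j}"
  let ?f = "\<lambda>(j, t, a, b). filter (\<lambda>x. 0 < x) (map (\<lambda>x. x + j) a @ b)"
  have "inj_on ?f ?S"
  proof (rule inj_onI)
    fix q q' assume q: "q \<in> ?S" and q': "q' \<in> ?S" and eq: "?f q = ?f q'"
    obtain j a b where Q: "q = (j, j, a, b)" and m: "(j, j, a, b) \<in> framed_partitions d n"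
      using q by (cases q) auto
    obtain j' a' b' where Q': "q' = (j', j', a', b')" and m': "(j', j', a', b') \<in> framed_partitions d n"
      using q' by (cases q') auto
    define F where "F = map (\<lambda>x. x + j) a @ b"
    define F' where "F' = map (\<lambda>x. x + j') a' @ b'"
    note r = framed_partitions_rectangle[OF m, folded F_def]
    note r' = framed_partitions_rectangle[OF m', folded F'_def]
    have ff: "filter (\<lambda>x. 0 < x) F = filter (\<lambda>x. 0 < x) F'"
      using eq unfolding Q Q' F_def F'_def by simp
    have pp: "part0 F i = part0 F' i" for i
      using part0_filter_pos[OF r(1), of i] part0_filter_pos[OF r'(1), of i] ff by simp
    \<comment> \<open>If one index were smaller, row \<open>j + d\<close> for that index would lie
      below its own rectangle but inside the larger one, so the entry there would be both too small
      and too large.\<close>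
    have jj: "j = j'"
    proof (rule ccontr)
      assume "j \<noteq> j'"
      then consider "j < j'" | "j' < j" by linarith
      then show False
        using r(3) r'(3) r(4)[of "j' + d"] r'(4)[of "j + d"] pp by cases auto
    qed
    have la: "length a = j + d" "length a' = j + d"
      using m m' jj by (auto simp: framed_partitions_def)
    have aa: "a = a'"
    proof (rule nth_equalityI)
      fix i assume "i < length a"
      then show "a ! i = a' ! i" using r(4)[of i] r'(4)[of i] pp[of i] la jj by simp
    qed (use la in simp)
    have "filter (\<lambda>x. 0 < x) b = b" "filter (\<lambda>x. 0 < x) b' = b'"
      using m m' by (auto simp: framed_partitions_def filter_id_conv)
    then have "b = b'" using ff aa jj by (simp add: F_def F'_def)
    then show "q = q'" using Q Q' jj aa by simp
  qed
  moreover have "?f ` ?S = partitions n"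
  proof
    show "?f ` ?S \<subseteq> partitions n"
      using framed_partitions_rectangle(5) by fastforce
    show "partitions n \<subseteq> ?f ` ?S"
    proof
      fix \<nu> assume \<nu>: "\<nu> \<in> partitions n"
      then have s: "sorted_wrt (\<ge>) \<nu>" and pos: "\<forall>x\<in>set \<nu>. 0 < x" and sum: "sum_list \<nu> = n"
        by (auto simp: partitions_def)
      \<comment> \<open>The least such \<open>j\<close> gives the bound below the rectangle;
        \<open>length \<nu>\<close> shows that one exists.\<close>
      define j where "j = (LEAST j. part0 \<nu> (j + d) \<le> j)"
      have "part0 \<nu> (length \<nu> + d) \<le> length \<nu>" by (simp add: part0_def)
      then have j: "part0 \<nu> (j + d) \<le> j" unfolding j_def by (rule LeastI)
      \<comment> \<open>Minimality, applied to \<open>j - 1\<close>, says that the last row of the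
        rectangle, at index \<open>j - 1 + d\<close>, has at least \<open>j\<close> cells; earlier
        rows are no shorter.\<close>
      have large: "j \<le> part0 \<nu> i" if "i < j + d" for i
      proof (cases j)
        case (Suc k)
        then have "\<not> part0 \<nu> (k + d) \<le> k" using not_less_Least[of k "\<lambda>j. part0 \<nu> (j + d) \<le> j"] unfolding j_def by simp
        moreover have "part0 \<nu> (k + d) \<le> part0 \<nu> i" using that Suc by (intro part0_antimono s) simp
        ultimately show ?thesis using Suc by simp
      qed simp
      define a where "a = map (\<lambda>i. part0 \<nu> i - j) [0..<j + d]"
      define b where "b = drop (j + d) \<nu>"
      have la: "length a = j + d" by (simp add: a_def)
      have ma: "map (\<lambda>x. x + j) a = map (part0 \<nu>) [0..<j + d]"
        using large by (auto simp: a_def)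
      have F: "map (\<lambda>x. x + j) a @ b = \<nu> @ replicate (j + d - length \<nu>) 0"
        unfolding ma b_def by (rule nth_equalityI) (auto simp: nth_append part0_def)
      have "filter (\<lambda>x. 0 < x) \<nu> = \<nu>" using pos by (simp add: filter_id_conv)
      then have f: "\<nu> = ?f (j, j, a, b)" unfolding prod.case F by simp
      have "sorted_wrt (\<ge>) a"
        unfolding a_def sorted_wrt_map
        by (rule sorted_wrt_mono_rel[of _ "(<)"]) (simp_all add: diff_le_mono part0_antimono[OF s])
      moreover have "x \<le> j" if x: "x \<in> set b" for x
      proof -
        obtain i where "i < length b" "x = b ! i" using x by (auto simp: in_set_conv_nth)
        moreover from this have "j + d + i < length \<nu>" by (simp add: b_def less_diff_conv2 add.commute)
        ultimately have "x = part0 \<nu> (j + d + i)" by (simp add: b_def part0_def)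
        also have "\<dots> \<le> part0 \<nu> (j + d)" by (intro part0_antimono s) simp
        finally show ?thesis using j by simp
      qed
      moreover have "1 \<le> x" if "x \<in> set b" for x
        using that pos in_set_dropD[of x "j + d" \<nu>] by (auto simp: b_def Suc_le_eq)
      moreover have "sum_list a + (j + d) * j + sum_list b = n"
      proof -
        have "sum_list (map (\<lambda>x. x + j) a @ b) = n" unfolding F using sum by (simp add: sum_list_replicate)
        then show ?thesis using la by (simp add: sum_list_map_add)
      qed
      ultimately have "(j, j, a, b) \<in> ?S"
        using s la by (auto simp: framed_partitions_def b_def sorted_wrt_drop)
      with f show "\<nu> \<in> ?f ` ?S" by (rule image_eqI)
    qed
  qed
  ultimately have "bij_betw ?f ?S (partitions n)" by (rule bij_betw_imageI)
  then show ?thesis by (rule bij_betw_same_card)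
qed

text \<open>Frames with \<open>t = j\<close> encode all partitions of \<open>n\<close>. Combined
  with \<open>card_framed_partitions_split\<close>, this gives the recurrence of
  \<open>card_based_partitions_rec\<close> for strict frames.\<close>

lemma card_framed_partitions:
  assumes d: "1 \<le> d"
  shows "card (framed_partitions d n) = card (partitions n) + card (strict_framed_partitions d n)"
proof -
  let ?S = "{(j, t, a, b) \<in> framed_partitions d n. t = j}"
  have un: "framed_partitions d n = ?S \<union> strict_framed_partitions d n"
    and disj: "?S \<inter> strict_framed_partitions d n = {}"
    by (auto simp: strict_framed_partitions_def framed_partitions_def)
  have "finite ?S"
    by (auto intro: finite_subset[OF _ finite_framed_partitions[OF d, of n]])
  from card_Un_disjoint[OF this finite_strict_framed_partitions[OF d] disj]
  have "card (framed_partitions d n) = card ?S + card (strict_framed_partitions d n)"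
    unfolding un[symmetric] .
  then show ?thesis by (simp only: card_durfee_rectangle[OF d])
qed

section \<open>Equality of the refined counts\<close>

lemma based_partitions_empty: "n < d \<Longrightarrow> based_partitions d n = {}"
  using mult_le_mono2[of 1 _ d] by (fastforce simp: based_partitions_def)

text \<open>From \<open>j < t\<close> there is at least one column, so the rectangle alone has at
  least \<open>d\<close> cells.\<close>

lemma strict_framed_partitions_empty:
  assumes "n < d"
  shows "strict_framed_partitions d n = {}"
proof -
  have False if *: "(j, t, a, b) \<in> strict_framed_partitions d n" for j t a b
  proof -
    have "j < t" and n: "sum_list a + (j + d) * t + sum_list b = n"
      using * by (auto simp: strict_framed_partitions_def framed_partitions_def)
    then have "j + d \<le> (j + d) * t" by (cases t) auto
    then show False using n assms by linarith
  qed
  then show ?thesis by fast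
qed

lemma card_based_eq_card_strict_framed:
  assumes "1 \<le> d"
  shows "card (based_partitions d n) = card (strict_framed_partitions d n)"
  using assms
proof (induction n arbitrary: d rule: less_induct)
  case (less n)
  show ?case
  proof (cases "n < d")
    case False
    \<comment> \<open>The recurrence at \<open>k\<close> expresses the count at \<open>n\<close>
      through counts at \<open>k\<close> with parameters \<open>d\<close> and \<open>Suc d\<close>,
      which is why \<open>d\<close> varies in the induction.\<close>
    define k where "k = n - d"
    have k: "n = k + d" "k < n" using False less.prems by (auto simp: k_def)
    show ?thesis
      using card_based_partitions_rec[OF less.prems, of k] card_framed_partitions[OF less.prems, of k]
        card_framed_partitions_split[OF less.prems, of k]
        less.IH[OF k(2) less.prems] less.IH[OF k(2), of "Suc d"]
      by (simp add: k(1))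
  qed (simp add: based_partitions_empty strict_framed_partitions_empty)
qed

section \<open>Encoding of marked partitions\<close>

lemma sorted_wrt_replicate_ge: "sorted_wrt (\<ge>) (replicate d (x :: nat))"
  by (induction d) auto

lemma bij_betw_marked_partitions:
  "bij_betw (\<lambda>(d, N, b). (b @ replicate d N, Suc (length b)))
     (SIGMA d:{1..n}. based_partitions d n) (marked_partitions n)"
  (is "bij_betw ?f ?S _")
proof (rule bij_betw_imageI)
  show "inj_on ?f ?S"
  proof (rule inj_onI)
    fix q q' assume q: "q \<in> ?S" "q' \<in> ?S" "?f q = ?f q'"
    obtain d N b d' N' b' where Q: "q = (d, N, b)" "q' = (d', N', b')" by (cases q, cases q') auto
    \<comment> \<open>The mark gives the length of \<open>b\<close>, hence the cut;
      \<open>1 \<le> d\<close> makes the remaining block nonempty, so it determines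
      \<open>N\<close>.\<close>
    have "b = b'" "replicate d N = replicate d' N'" "1 \<le> d" using q Q by auto
    then show "q = q'" using Q by (auto simp: replicate_eq_replicate)
  qed
  show "?f ` ?S = marked_partitions n"
  proof
    show "?f ` ?S \<subseteq> marked_partitions n"
    proof (rule image_subsetI)
      fix q assume q: "q \<in> ?S"
      obtain d N b where Q: "q = (d, N, b)" by (cases q) auto
      have d: "1 \<le> d" and *: "1 \<le> N" "sorted_wrt (\<ge>) b" "\<forall>x\<in>set b. N \<le> x" "sum_list b + d * N = n"
        using q Q by (auto simp: based_partitions_def)
      have "Min (set (b @ replicate d N)) = N" using d * by (intro Min_eqI) auto
      moreover have "b @ replicate d N \<in> partitions n"
        using * sorted_wrt_replicate_ge[of d N]
        by (auto simp: partitions_def sorted_wrt_append sum_list_replicate)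
      ultimately show "?f q \<in> marked_partitions n"
        using d Q by (simp add: marked_partitions_def smallest_part_def part_at_def nth_append)
    qed
    show "marked_partitions n \<subseteq> ?f ` ?S"
    proof
      fix q assume q: "q \<in> marked_partitions n"
      obtain \<mu> k where Q: "q = (\<mu>, k)" by (cases q) auto
      have \<mu>: "sorted_wrt (\<ge>) \<mu>" "\<forall>x\<in>set \<mu>. 0 < x" "sum_list \<mu> = n" and k: "1 \<le> k" "k \<le> length \<mu>"
        and m: "\<mu> ! (k - 1) = Min (set \<mu>)"
        using q Q by (auto simp: marked_partitions_def partitions_def smallest_part_def part_at_def)
      define N where "N = \<mu> ! (k - 1)"
      define b where "b = take (k - 1) \<mu>"
      define d where "d = length \<mu> - (k - 1)"
      have N: "N \<le> x" if "x \<in> set \<mu>" for x using that m by (simp add: N_def)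
      \<comment> \<open>Parts after the mark are at most the marked part by order and at least it by
        minimality.\<close>
      have "drop (k - 1) \<mu> = replicate d N"
      proof (rule nth_equalityI)
        fix i assume i: "i < length (drop (k - 1) \<mu>)"
        then have "\<mu> ! (k - 1 + i) \<le> N"
          using sorted_wrt_nth_less[OF \<mu>(1), of "k - 1" "k - 1 + i"] by (cases "i = 0") (auto simp: N_def)
        moreover have "N \<le> \<mu> ! (k - 1 + i)" using i by (intro N nth_mem) simp
        ultimately show "drop (k - 1) \<mu> ! i = replicate d N ! i" using i by (simp add: d_def)
      qed (simp add: d_def)
      then have split: "\<mu> = b @ replicate d N" by (metis append_take_drop_id b_def)
      have "N \<in> set \<mu>" unfolding N_def using k by (intro nth_mem) simp
      then have N1: "1 \<le> N" using \<mu>(2) by (simp add: Suc_le_eq)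
      have d1: "1 \<le> d" using k by (simp add: d_def)
      have "sum_list b + d * N = n" using \<mu>(3) split by (simp add: sum_list_replicate)
      moreover have "d \<le> d * N" using N1 by (cases N) auto
      ultimately have "d \<le> n" "sum_list b + d * N = n" by linarith+
      then have "(d, N, b) \<in> ?S"
        using N1 d1 N \<mu>(1) by (auto simp: based_partitions_def b_def dest: in_set_takeD)
      moreover have "Suc (length b) = k" using k by (simp add: b_def)
      then have "q = ?f (d, N, b)" using Q by (simp flip: split)
      ultimately show "q \<in> ?f ` ?S" by (rule rev_image_eqI)
    qed
  qed
qed

section \<open>Durfee squares and conjugates in terms of counts of large parts\<close>

text \<open>The corner cell \<open>(d, d)\<close> decides: it forces the first \<open>d\<close>
  parts to be at least \<open>d\<close>. Conversely, the parts that are at least \<open>d\<close>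
  come first.\<close>

lemma square_subset_young_diagram_iff:
  assumes "sorted_wrt (\<ge>) \<nu>"
  shows "{1..d} \<times> {1..d} \<subseteq> young_diagram \<nu> \<longleftrightarrow> d \<le> length (filter (\<lambda>x. x \<ge> d) \<nu>)"
proof
  assume sub: "{1..d} \<times> {1..d} \<subseteq> young_diagram \<nu>"
  show "d \<le> length (filter (\<lambda>x. x \<ge> d) \<nu>)"
  proof (cases "d = 0")
    case False
    then have "(d, d) \<in> young_diagram \<nu>" using sub by auto
    then have d: "d \<le> length \<nu>" "d \<le> \<nu> ! (d - 1)" by (auto simp: young_diagram_def part_at_def)
    have "d \<le> \<nu> ! i" if "i < d" for i
      using sorted_wrt_nth_less[OF assms, of i "d - 1"] that d
      by (cases "i < d - 1") (auto dest: le_neq_implies_less intro: order_trans simp: not_less)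
    then have "filter (\<lambda>x. x \<ge> d) (take d \<nu>) = take d \<nu>"
      using d by (auto simp: filter_id_conv in_set_conv_nth)
    then have "d \<le> length (filter (\<lambda>x. x \<ge> d) (take d \<nu> @ drop d \<nu>))"
      unfolding filter_append using d by simp
    then show ?thesis by simp
  qed simp
next
  let ?A = "filter (\<lambda>x. x \<ge> d) \<nu>"
  assume d: "d \<le> length ?A"
  have "d \<le> \<nu> ! i" if "i < d" for i
  proof -
    have "\<nu> ! i = (?A @ filter (\<lambda>x. x < d) \<nu>) ! i"
      by (rule arg_cong[where f = "\<lambda>xs. xs ! i"]) (rule sorted_ge_filter_append[OF assms])
    also have "\<dots> = ?A ! i"
      using that d by (simp add: nth_append)
    finally have "\<nu> ! i = ?A ! i" .
    moreover have "?A ! i \<in> set ?A" using that d by (intro nth_mem) simp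
    ultimately show ?thesis by simp
  qed
  then have "e \<le> \<nu> ! (i - 1)" if "i \<in> {1..d}" "e \<le> d" for i e
    using that by (metis One_nat_def Suc_le_eq Suc_pred atLeastAtMost_iff order_trans)
  moreover have "d \<le> length \<nu>" using d length_filter_le order_trans by blast
  ultimately show "{1..d} \<times> {1..d} \<subseteq> young_diagram \<nu>"
    by (auto simp: young_diagram_def part_at_def)
qed

text \<open>The sides of squares contained in the diagram form a finite set closed downwards, so
  lying below its maximum is the same as membership.\<close>

lemma le_durfee_iff:
  assumes "sorted_wrt (\<ge>) \<nu>"
  shows "s \<le> durfee \<nu> \<longleftrightarrow> s \<le> length (filter (\<lambda>x. x \<ge> s) \<nu>)"
proof -
  let ?D = "{d. {1..d} \<times> {1..d} \<subseteq> young_diagram \<nu>}"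
  have "?D \<subseteq> {..length \<nu>}"
    using square_subset_young_diagram_iff[OF assms] length_filter_le order_trans by blast
  then have fin: "finite ?D" by (rule finite_subset) simp
  have "0 \<in> ?D" by simp
  then have "Max ?D \<in> ?D" using Max_in[OF fin] by blast
  then have "s \<in> ?D" if "s \<le> Max ?D"
    using that by fastforce
  then have "s \<le> durfee \<nu> \<longleftrightarrow> s \<in> ?D"
    unfolding durfee_def using Max_ge[OF fin] by blast
  then show ?thesis using square_subset_young_diagram_iff[OF assms] by simp
qed

lemma part_at_conjugate:
  assumes "1 \<le> s" "s \<le> part_at \<nu> 1"
  shows "part_at (conjugate \<nu>) s = length (filter (\<lambda>x. x \<ge> s) \<nu>)"
proof -
  have "[1..<Suc (part_at \<nu> 1)] ! (s - 1) = s" using assms by (subst nth_upt) auto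
  then show ?thesis
    unfolding part_at_def[of "conjugate \<nu>" s] using assms
    by (simp add: conjugate_def del: upt_Suc)
qed

section \<open>Encoding of doubly marked partitions\<close>

text \<open>Equal columns \<open>s\<close> and \<open>t\<close> mean that no part lies in the range
  from \<open>s\<close> to \<open>t - 1\<close>. Parts that are at least \<open>s\<close> thus
  contain full rows of length \<open>t\<close>, with remainders \<open>a\<close>; the others form
  \<open>b\<close>. The Durfee condition says exactly that \<open>d\<close> is positive.\<close>

lemma bij_betw_doubly_marked_partitions:
  "bij_betw (\<lambda>(d, j, t, a, b). (map (\<lambda>x. x + t) a @ b, Suc j, t))
     (SIGMA d:{1..n}. strict_framed_partitions d n) (doubly_marked_partitions n)"
  (is "bij_betw ?f ?S _")
proof (rule bij_betw_imageI)
  \<comment> \<open>Every part is at least \<open>t\<close> or at most \<open>j\<close>, so each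
    threshold \<open>s\<close> with \<open>j < s \<le> t\<close> recovers the same two
    blocks.\<close>
  have filters: "filter (\<lambda>x. x \<ge> s) (map (\<lambda>x. x + t) a @ b) = map (\<lambda>x. x + t) a"
    "filter (\<lambda>x. x < s) (map (\<lambda>x. x + t) a @ b) = b"
    if "(j, t, a, b) \<in> strict_framed_partitions d n" "j < s" "s \<le> t" for d j t a b s
  proof -
    have "\<forall>x\<in>set b. x < s"
      using that by (fastforce simp: strict_framed_partitions_def framed_partitions_def)
    then have "filter (\<lambda>x. x \<ge> s) b = []" "filter (\<lambda>x. x < s) b = b"
      by (auto simp: filter_empty_conv filter_id_conv)
    moreover have "filter (\<lambda>x. x \<ge> s) (map (\<lambda>x. x + t) a) = map (\<lambda>x. x + t) a"
      "filter (\<lambda>x. x < s) (map (\<lambda>x. x + t) a) = []"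
      using that by (auto simp: filter_empty_conv filter_id_conv)
    ultimately show "filter (\<lambda>x. x \<ge> s) (map (\<lambda>x. x + t) a @ b) = map (\<lambda>x. x + t) a"
      "filter (\<lambda>x. x < s) (map (\<lambda>x. x + t) a @ b) = b"
      by (simp_all only: filter_append append_Nil append_Nil2)
  qed
  show "inj_on ?f ?S"
  proof (rule inj_onI)
    fix q q' assume q: "q \<in> ?S" "q' \<in> ?S" "?f q = ?f q'"
    obtain d j t a b where Q: "q = (d, j, t, a, b)" by (cases q) auto
    obtain d' j' t' a' b' where Q': "q' = (d', j', t', a', b')" by (cases q') auto
    have m: "(j, t, a, b) \<in> strict_framed_partitions d n" "(j', t', a', b') \<in> strict_framed_partitions d' n"
      using q Q Q' by auto
    have eq: "j' = j" "t' = t" "map (\<lambda>x. x + t) a @ b = map (\<lambda>x. x + t) a' @ b'" using q Q Q' by auto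
    have "j < t" using m by (simp add: strict_framed_partitions_def)
    then have "map (\<lambda>x. x + t) a = map (\<lambda>x. x + t) a'" "b = b'"
      using filters[OF m(1), of t] filters[OF m(2), of t] unfolding eq by simp_all
    moreover have "inj (\<lambda>x. x + t)" by (simp add: inj_def)
    ultimately have "a = a'" by (metis map_injective)
    \<comment> \<open>The image does not record \<open>d\<close>; it is recovered from the number of
      rows.\<close>
    moreover have "d = length a - j" "d' = length a' - j'"
      using m by (auto simp: strict_framed_partitions_def framed_partitions_def)
    ultimately show "q = q'" using Q Q' eq \<open>b = b'\<close> by simp
  qed
  show "?f ` ?S = doubly_marked_partitions n"
  proof
    show "?f ` ?S \<subseteq> doubly_marked_partitions n"
    proof (rule image_subsetI)
      fix q assume q: "q \<in> ?S"
      obtain d j t a b where Q: "q = (d, j, t, a, b)" by (cases q) auto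
      have d: "1 \<le> d" and m: "(j, t, a, b) \<in> strict_framed_partitions d n" using q Q by auto
      define \<nu> where "\<nu> = map (\<lambda>x. x + t) a @ b"
      have jt: "j < t" and a: "sorted_wrt (\<ge>) a" "length a = j + d"
        and b: "sorted_wrt (\<ge>) b" "\<forall>x\<in>set b. 1 \<le> x \<and> x \<le> j"
        and sum: "sum_list a + (j + d) * t + sum_list b = n"
        using m by (auto simp: strict_framed_partitions_def framed_partitions_def)
      have s: "sorted_wrt (\<ge>) \<nu>"
        unfolding \<nu>_def using a b jt by (intro sorted_ge_map_add_append) auto
      have "sum_list \<nu> = n" using sum a by (simp add: \<nu>_def sum_list_map_add)
      then have "\<nu> \<in> partitions n" using s b jt by (auto simp: partitions_def \<nu>_def)
      moreover have len: "length (filter (\<lambda>x. x \<ge> s) \<nu>) = j + d" if "j < s" "s \<le> t" for s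
        using filters(1)[OF m that] a by (simp add: \<nu>_def)
      moreover have "t \<le> part_at \<nu> 1"
        using a d by (simp add: part_at_def \<nu>_def nth_append)
      ultimately show "?f q \<in> doubly_marked_partitions n"
        using Q jt d len[of "Suc j"] len[of t] part_at_conjugate[of "Suc j" \<nu>] part_at_conjugate[of t \<nu>]
        by (simp add: doubly_marked_partitions_def le_durfee_iff[OF s] flip: \<nu>_def)
    qed
    show "doubly_marked_partitions n \<subseteq> ?f ` ?S"
    proof
      fix q assume q: "q \<in> doubly_marked_partitions n"
      obtain \<nu> s t where Q: "q = (\<nu>, s, t)" by (cases q) auto
      have \<nu>: "sorted_wrt (\<ge>) \<nu>" "\<forall>x\<in>set \<nu>. 0 < x" "sum_list \<nu> = n"
        using q Q by (auto simp: doubly_marked_partitions_def partitions_def)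
      have s: "1 \<le> s" "s \<le> t" "t \<le> part_at \<nu> 1" "s \<le> durfee \<nu>"
        using q Q by (auto simp: doubly_marked_partitions_def)
      define A where "A = filter (\<lambda>x. x \<ge> s) \<nu>"
      define b where "b = filter (\<lambda>x. x < s) \<nu>"
      define a where "a = map (\<lambda>x. x - t) A"
      have "length (filter (\<lambda>x. x \<ge> t) \<nu>) = length A"
        using q Q s part_at_conjugate[of s \<nu>] part_at_conjugate[of t \<nu>]
        by (simp add: doubly_marked_partitions_def A_def)
      \<comment> \<open>Both filters are prefixes of \<open>\<nu>\<close> of the same
        length.\<close>
      then have At: "A = filter (\<lambda>x. x \<ge> t) \<nu>"
        using sorted_ge_filter_append[OF \<nu>(1), of s] sorted_ge_filter_append[OF \<nu>(1), of t]
        unfolding A_def by (metis append_eq_append_conv)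
      have "map (\<lambda>x. x + t) a = A"
        unfolding a_def map_map by (rule map_idI) (simp add: At)
      then have split: "map (\<lambda>x. x + t) a @ b = \<nu>"
        using sorted_ge_filter_append[OF \<nu>(1), of s] by (simp add: A_def b_def)
      have sA: "s \<le> length A" using s by (simp add: le_durfee_iff[OF \<nu>(1)] A_def)
      have "sorted_wrt (\<ge>) A" unfolding A_def by (rule sorted_wrt_filter) (rule \<nu>)
      then have sa: "sorted_wrt (\<ge>) a"
        unfolding a_def sorted_wrt_map by (rule sorted_wrt_mono_rel[rotated]) auto
      \<comment> \<open>Here \<open>j = s - 1\<close>, and \<open>s \<le> length A\<close> makes
        \<open>d\<close> positive.\<close>
      define d where "d = length A - (s - 1)"
      have la: "length a = s - 1 + d" using sA by (simp add: a_def d_def)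
      have sum: "sum_list a + (s - 1 + d) * t + sum_list b = n"
        using arg_cong[OF split, of sum_list] \<nu>(3) la by (simp add: sum_list_map_add)
      have "length A \<le> n"
        using length_filter_le[of _ \<nu>] length_le_sum_list[OF \<nu>(2)] \<nu>(3) unfolding A_def
        by (metis order_trans)
      then have "d \<in> {1..n}" using sA s by (auto simp: d_def)
      moreover have "(s - 1, t, a, b) \<in> strict_framed_partitions d n"
        using s sa la sum \<nu> sorted_wrt_filter[OF \<nu>(1)]
        by (auto simp: strict_framed_partitions_def framed_partitions_def b_def Suc_le_eq)
      ultimately have "(d, s - 1, t, a, b) \<in> ?S" by simp
      moreover have "q = ?f (d, s - 1, t, a, b)" using Q split s by simp
      ultimately show "q \<in> ?f ` ?S" by (rule rev_image_eqI)
    qed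
  qed
qed

theorem theorem3p1:
  fixes n :: nat
  assumes "n > 0"
  shows "\<exists>f. bij_betw f (marked_partitions n) (doubly_marked_partitions n)"
proof -
  let ?M = "SIGMA d:{1..n}. based_partitions d n"
  let ?D = "SIGMA d:{1..n}. strict_framed_partitions d n"
  have "card ?M = card ?D"
    using finite_based_partitions finite_strict_framed_partitions
    by (simp add: card_SigmaI card_based_eq_card_strict_framed)
  moreover have "finite ?M" "finite ?D"
    by (auto intro!: finite_SigmaI finite_based_partitions finite_strict_framed_partitions)
  \<comment> \<open>Only equality of the finite cardinalities yields \<open>g\<close>; the two
    encodings then carry it over to the original sets.\<close>
  ultimately obtain g where "bij_betw g ?M ?D"
    using finite_same_card_bij by blast
  then show ?thesis
    using bij_betw_marked_partitions[of n] bij_betw_doubly_marked_partitions[of n]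
    by (meson bij_betw_inv_into bij_betw_trans)
qed

end
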